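(* Let $Q$ be a complete normed linear space, let $P\subseteq Q$ be nonempty, closed and convex, and let $R:P\to P$ be a weak contraction with constants $\zeta\in(0,1)$ and $L\ge 0$, that is, $$\|Rp-Rq\|\le \zeta\|p-q\|+L\|q-Rp\|\quad\text{for all }p,q\in P,$$ which in addition satisfies $$\|Rp-Rq\|\le \zeta\|p-q\|+L\|p-Rp\|\quad\text{for all }p,q\in P.$$ Let $(a_m)_{m\ge 0}$ be a sequence in $(0,1)$, let $s_0\in P$, and let $\{s_m\}$ be the sequence generated from $s_0$ by the $AT$ iterative algorithm for $R$ with control sequence $(a_m)$. Then $R$ has a unique fixed point $s$ in $P$, and $\{s_m\}$ converges strongly (in norm) to $s$.
   Context: $\mathbb{Z}_+$ denotes the set of nonnegative integers. The $AT$ iterative algorithm for a self-map $R$ of $P$, with control sequence $(a_m)$ in $(0,1)$ and initial point $s_0\in P$, is defined for $m\in\mathbb{Z}_+$ by $$b_m=\tfrac12 R^2(s_m)+\tfrac12 R^2\big((1-a_m)s_m+a_mRs_m\big),\qquad s_{m+1}=R\big((1-a_m)b_m+a_mRb_m\big),$$ where $R^2=R\circ R$. *)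

theory Defs
  imports "HOL-Analysis.Analysis"
begin

text \<open>A self-map of \<open>P\<close> is a total function on the ambient type that maps \<open>P\<close> into itself;
  its values outside \<open>P\<close> are irrelevant.\<close>

definition weak_contraction_on ::
    "'a::real_normed_vector set \<Rightarrow> real \<Rightarrow> real \<Rightarrow> ('a \<Rightarrow> 'a) \<Rightarrow> bool" where
  "weak_contraction_on P \<zeta> L R \<longleftrightarrow>
     R \<in> P \<rightarrow> P \<and> 0 < \<zeta> \<and> \<zeta> < 1 \<and> 0 \<le> L \<and>
     (\<forall>p\<in>P. \<forall>q\<in>P. norm (R p - R q) \<le> \<zeta> * norm (p - q) + L * norm (q - R p))"

definition AT_inner :: "('a::real_vector \<Rightarrow> 'a) \<Rightarrow> real \<Rightarrow> 'a \<Rightarrow> 'a" where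
  "AT_inner R a x =
     (1/2) *\<^sub>R (R ^^ 2) x + (1/2) *\<^sub>R (R ^^ 2) ((1 - a) *\<^sub>R x + a *\<^sub>R R x)"

primrec AT_seq :: "('a::real_vector \<Rightarrow> 'a) \<Rightarrow> (nat \<Rightarrow> real) \<Rightarrow> 'a \<Rightarrow> nat \<Rightarrow> 'a" where
  "AT_seq R a s0 0 = s0"
| "AT_seq R a s0 (Suc m) =
     (let b = AT_inner R (a m) (AT_seq R a s0 m)
      in R ((1 - a m) *\<^sub>R b + a m *\<^sub>R R b))"

end

theory Submission
  imports Defs
begin

text \<open>
  The weak contraction inequality at \<open>p = x\<close>, \<open>q = R x\<close> loses its second term, because
  \<open>q - R p = 0\<close>. Hence consecutive Picard iterates approach each other geometrically, and
  completeness gives a limit; the same inequality at \<open>q\<close> equal to the limit shows that this limit is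
  fixed (\<open>weak_contraction_has_fixed_point\<close>).

  The dual inequality at a fixed point \<open>p = s\<close> also loses its second term and leaves
  \<open>\<parallel>R q - s\<parallel> \<le> \<zeta> \<parallel>q - s\<parallel>\<close>. This makes the fixed point unique. It also says that \<open>R\<close>
  maps \<open>P \<inter> cball s r\<close> into \<open>P \<inter> cball s (\<zeta> * r)\<close>. Those sets are convex, so every averaging
  step with weights in \<open>[0, 1]\<close> stays inside them, while every application of \<open>R\<close> reduces the
  radius. One step of the iteration therefore contracts the distance to \<open>s\<close> by at least
  the factor \<open>\<zeta>\<close> (\<open>AT_seq_geometric_bound\<close>), and convergence follows.
\<close>

text \<open>
  The increments are dominated by a geometric series, so their telescoping sum converges.
\<close>

lemma convergent_if_geometric_increments:
  fixes x :: "nat \<Rightarrow> 'a::banach"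
  assumes "0 \<le> c" "c < 1"
    and step: "\<And>n. norm (x (Suc (Suc n)) - x (Suc n)) \<le> c * norm (x (Suc n) - x n)"
  shows "convergent x"
proof -
  have bound: "norm (x (Suc n) - x n) \<le> c ^ n * norm (x 1 - x 0)" for n
  proof (induction n)
    case 0
    show ?case by simp
  next
    case (Suc n)
    have "norm (x (Suc (Suc n)) - x (Suc n)) \<le> c * norm (x (Suc n) - x n)"
      by (rule step)
    also have "\<dots> \<le> c * (c ^ n * norm (x 1 - x 0))"
      using Suc.IH \<open>0 \<le> c\<close> by (rule mult_left_mono)
    finally show ?case by simp
  qed
  have "summable (\<lambda>n. c ^ n * norm (x 1 - x 0))"
    using assms(1,2) by (intro summable_mult2 summable_geometric) simp
  then have "summable (\<lambda>n. x (Suc n) - x n)"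
    by (rule summable_comparison_test'[where N = 0]) (rule bound)
  then have "convergent (\<lambda>n. x n - x 0)"
    by (simp add: summable_iff_convergent sum_lessThan_telescope)
  then show ?thesis
    by (simp add: convergent_diff_const_right_iff)
qed

lemma weak_contraction_has_fixed_point:
  fixes P :: "'a::banach set"
  assumes "P \<noteq> {}" "closed P" and R: "weak_contraction_on P \<zeta> L R"
  obtains s where "s \<in> P" "R s = s"
proof -
  from R have maps: "R y \<in> P" if "y \<in> P" for y
    using that by (auto simp: weak_contraction_on_def)
  from R have \<zeta>: "0 < \<zeta>" "\<zeta> < 1"
    by (auto simp: weak_contraction_on_def)
  from R have contr: "norm (R p - R q) \<le> \<zeta> * norm (p - q) + L * norm (q - R p)"
      if "p \<in> P" "q \<in> P" for p q
    using that by (auto simp: weak_contraction_on_def)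
  obtain x0 where "x0 \<in> P" using \<open>P \<noteq> {}\<close> by blast
  define x where "x n = (R ^^ n) x0" for n
  have x_Suc: "x (Suc n) = R (x n)" for n
    by (simp add: x_def)
  have x_in: "x n \<in> P" for n
    by (induction n) (simp_all add: x_def \<open>x0 \<in> P\<close> maps)
  have "norm (x (Suc (Suc n)) - x (Suc n)) \<le> \<zeta> * norm (x (Suc n) - x n)" for n
    using contr[OF x_in[of n] x_in[of "Suc n"]] by (simp add: x_Suc norm_minus_commute)
  with \<zeta> have "convergent x"
    by (intro convergent_if_geometric_increments[of \<zeta>]) auto
  then obtain s where lim: "x \<longlonglongrightarrow> s"
    by (auto simp: convergent_def)
  have "s \<in> P"
    using \<open>closed P\<close> x_in lim by (rule closed_sequentially)
  have lim_Suc: "(\<lambda>n. x (Suc n)) \<longlonglongrightarrow> s"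
    using lim by (rule LIMSEQ_Suc)
  have lim_bound: "(\<lambda>n. \<zeta> * norm (x n - s) + L * norm (s - x (Suc n)))
          \<longlonglongrightarrow> \<zeta> * norm (s - s) + L * norm (s - s)"
    by (intro tendsto_intros lim lim_Suc)
  have "norm (x (Suc n) - R s) \<le> \<zeta> * norm (x n - s) + L * norm (s - x (Suc n))" for n
    using contr[OF x_in[of n] \<open>s \<in> P\<close>] by (simp add: x_Suc)
  moreover have "(\<lambda>n. \<zeta> * norm (x n - s) + L * norm (s - x (Suc n))) \<longlonglongrightarrow> 0"
    using lim_bound by simp
  ultimately have "(\<lambda>n. x (Suc n) - R s) \<longlonglongrightarrow> 0"
    by (rule Lim_null_comparison[OF eventuallyI])
  then have "(\<lambda>n. x (Suc n)) \<longlonglongrightarrow> R s"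
    by (simp add: LIM_zero_iff)
  with lim_Suc have "R s = s"
    by (rule LIMSEQ_unique[symmetric])
  with \<open>s \<in> P\<close> show thesis by (rule that)
qed

text \<open>
  A ball around \<open>s\<close> intersected with \<open>P\<close> is convex and invariant under \<open>R\<close>, so it contains every
  point that one step computes from its current iterate, and the outermost \<open>R\<close> then contributes a
  factor \<open>\<zeta>\<close>. The same argument applied to the two inner applications of \<open>R\<close> would give
  \<open>\<zeta> ^ 3\<close> per step; one factor already yields convergence when \<open>\<zeta> < 1\<close>.
\<close>

lemma AT_seq_geometric_bound:
  fixes P :: "'a::real_normed_vector set"
  assumes "convex P" and maps: "R \<in> P \<rightarrow> P"
    and \<zeta>: "0 \<le> \<zeta>" "\<zeta> \<le> 1"
    and pull: "\<And>q. q \<in> P \<Longrightarrow> norm (R q - s) \<le> \<zeta> * norm (q - s)"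
    and a: "\<And>m. 0 \<le> a m" "\<And>m. a m \<le> 1"
    and "s0 \<in> P"
  shows "AT_seq R a s0 m \<in> P \<inter> cball s (\<zeta> ^ m * norm (s0 - s))"
proof (induction m)
  case 0
  show ?case using \<open>s0 \<in> P\<close> by (simp add: dist_norm norm_minus_commute)
next
  case (Suc m)
  let ?r = "\<zeta> ^ m * norm (s0 - s)"
  let ?B = "P \<inter> cball s ?r"
  have conv: "convex ?B"
    using \<open>convex P\<close> by (intro convex_Int convex_cball)
  have shrink: "R y \<in> P \<inter> cball s (\<zeta> * ?r)" if "y \<in> ?B" for y
  proof -
    have "norm (R y - s) \<le> \<zeta> * norm (y - s)"
      using pull that by simp
    also have "\<dots> \<le> \<zeta> * ?r"
      using that \<zeta>(1) by (intro mult_left_mono) (auto simp: dist_norm norm_minus_commute)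
    finally show ?thesis
      using maps that by (auto simp: dist_norm norm_minus_commute)
  qed
  have "\<zeta> * ?r \<le> ?r"
    using \<zeta> by (intro mult_left_le_one_le) auto
  with shrink have inv: "R y \<in> ?B" if "y \<in> ?B" for y
    using that by fastforce
  have mix: "(1 - a m) *\<^sub>R y + a m *\<^sub>R R y \<in> ?B" if "y \<in> ?B" for y
    by (intro convexD_alt[OF conv] that inv a)
  define b where "b = AT_inner R (a m) (AT_seq R a s0 m)"
  have "b \<in> ?B"
    unfolding b_def AT_inner_def numeral_2_eq_2 funpow.simps comp_def id_def
    by (intro convexD[OF conv] inv mix Suc.IH) auto
  then have "R ((1 - a m) *\<^sub>R b + a m *\<^sub>R R b) \<in> P \<inter> cball s (\<zeta> * ?r)"
    by (intro shrink mix)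
  then show ?case
    by (simp add: b_def Let_def mult.assoc)
qed

theorem theorem2:
  fixes P :: "'q::banach set" and R :: "'q \<Rightarrow> 'q"
    and \<zeta> L :: real and a :: "nat \<Rightarrow> real" and s0 :: 'q
  assumes "P \<noteq> {}" and "closed P" and "convex P"
    and "weak_contraction_on P \<zeta> L R"
    and "\<forall>p\<in>P. \<forall>q\<in>P. norm (R p - R q) \<le> \<zeta> * norm (p - q) + L * norm (p - R p)"
    and "\<forall>m. a m \<in> {0<..<1}"
    and "s0 \<in> P"
  shows "(\<exists>!s. s \<in> P \<and> R s = s) \<and>
         (\<forall>s\<in>P. R s = s \<longrightarrow> AT_seq R a s0 \<longlonglongrightarrow> s)"
proof -
  from assms(4) have \<zeta>: "0 < \<zeta>" "\<zeta> < 1" and maps: "R \<in> P \<rightarrow> P"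
    by (auto simp: weak_contraction_on_def)
  have pull: "norm (R q - s) \<le> \<zeta> * norm (q - s)" if "s \<in> P" "R s = s" "q \<in> P" for s q
    using assms(5)[rule_format, of s q] that by (simp add: norm_minus_commute)
  have unique: "t = s" if "s \<in> P" "R s = s" "t \<in> P" "R t = t" for s t
  proof -
    have "norm (t - s) \<le> \<zeta> * norm (t - s)"
      using pull[of s t] that by simp
    then have "(1 - \<zeta>) * norm (t - s) \<le> 0"
      by (simp add: algebra_simps)
    with \<zeta>(2) show ?thesis
      by (simp add: mult_le_0_iff)
  qed
  obtain s where "s \<in> P" "R s = s"
    using weak_contraction_has_fixed_point[OF assms(1,2,4)] .
  with unique have "\<exists>!s. s \<in> P \<and> R s = s"
    by blast
  moreover have "AT_seq R a s0 \<longlonglongrightarrow> s" if s: "s \<in> P" "R s = s" for s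
  proof -
    have "AT_seq R a s0 m \<in> P \<inter> cball s (\<zeta> ^ m * norm (s0 - s))" for m
      using assms(3,6,7) \<zeta> maps pull[OF s]
      by (intro AT_seq_geometric_bound) (auto simp: less_imp_le)
    then have "norm (AT_seq R a s0 m - s) \<le> \<zeta> ^ m * norm (s0 - s)" for m
      by (simp add: dist_norm norm_minus_commute)
    moreover have "(\<lambda>m. \<zeta> ^ m * norm (s0 - s)) \<longlonglongrightarrow> 0"
      using \<zeta> by (intro tendsto_mult_left_zero LIMSEQ_realpow_zero) auto
    ultimately have "(\<lambda>m. AT_seq R a s0 m - s) \<longlonglongrightarrow> 0"
      by (rule Lim_null_comparison[OF eventuallyI])
    then show ?thesis
      by (simp add: LIM_zero_iff)
  qed
  ultimately show ?thesis by blast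
qed

end
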